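(* Let $\mathbb{F}$ be a field. For the Erdős–Rényi random graph $G = G(n,\tfrac12)$ on $n$ vertices, $$\Pr\big[\mathbb{F}\langle\langle A_G \rangle\rangle = M_n(\mathbb{F})\big] \to 1 \quad \text{as } n \to \infty.$$
   Context: $A_G$ is the adjacency matrix of $G$. $M_n(\mathbb{F})$ carries two multiplications: the matrix product $\bullet$, with identity $I$, and the Hadamard (entrywise) product $\circ$, with identity $J$, the all-ones matrix. For $a \in M_n(\mathbb{F})$, $\mathbb{F}\langle\langle a \rangle\rangle$ denotes the smallest linear subspace of $M_n(\mathbb{F})$ that contains $a$, $I$ and $J$ and is closed under both $\bullet$ and $\circ$. *)

theory Defs
  imports
    "Jordan_Normal_Form.Matrix"
    "HOL-Probability.Product_PMF"
begin

text \<open>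
  Graphs on \<open>n\<close> vertices have vertex set \<open>{..<n}\<close> and are given by their edge set, a set of
  two-element subsets of \<open>{..<n}\<close>.
\<close>

definition vertex_pairs :: "nat \<Rightarrow> nat set set" where
  "vertex_pairs n = {e. e \<subseteq> {..<n} \<and> card e = 2}"

text \<open>
  The Erdos-Renyi random graph \<open>G(n, p)\<close>, as a distribution on edge sets: each pair of vertices
  is an edge with probability \<open>p\<close>, independently of all other pairs.
\<close>

definition erdos_renyi :: "nat \<Rightarrow> real \<Rightarrow> nat set set pmf" where
  "erdos_renyi n p =
     map_pmf (\<lambda>f. {e \<in> vertex_pairs n. f e})
       (Pi_pmf (vertex_pairs n) False (\<lambda>_. bernoulli_pmf p))"

definition adjacency_mat :: "nat \<Rightarrow> nat set set \<Rightarrow> 'a :: {zero, one} mat" where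
  "adjacency_mat n E = Matrix.mat n n (\<lambda>(i, j). if {i, j} \<in> E then 1 else 0)"

definition all_ones_mat :: "nat \<Rightarrow> 'a :: one mat" where
  "all_ones_mat n = Matrix.mat n n (\<lambda>_. 1)"

definition hadamard_prod :: "'a :: times mat \<Rightarrow> 'a mat \<Rightarrow> 'a mat" where
  "hadamard_prod A B = Matrix.mat (dim_row A) (dim_col A) (\<lambda>ij. A $$ ij * B $$ ij)"

definition linear_subspace_mat :: "nat \<Rightarrow> 'a :: field mat set \<Rightarrow> bool" where
  "linear_subspace_mat n S \<longleftrightarrow>
     S \<subseteq> carrier_mat n n \<and> 0\<^sub>m n n \<in> S \<and>
     (\<forall>A\<in>S. \<forall>B\<in>S. A + B \<in> S) \<and> (\<forall>c. \<forall>A\<in>S. c \<cdot>\<^sub>m A \<in> S)"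

definition double_subalgebra :: "nat \<Rightarrow> 'a :: field mat set \<Rightarrow> bool" where
  "double_subalgebra n S \<longleftrightarrow>
     linear_subspace_mat n S \<and> 1\<^sub>m n \<in> S \<and> all_ones_mat n \<in> S \<and>
     (\<forall>A\<in>S. \<forall>B\<in>S. A * B \<in> S) \<and> (\<forall>A\<in>S. \<forall>B\<in>S. hadamard_prod A B \<in> S)"

text \<open>
  For \<open>a \<in> carrier_mat n n\<close> the intersection below is over a nonempty family, and it is itself the
  least member of that family: see the three lemmas that follow.
\<close>

definition generated_double_algebra :: "nat \<Rightarrow> 'a :: field mat \<Rightarrow> 'a mat set" where
  "generated_double_algebra n a = \<Inter> {S. double_subalgebra n S \<and> a \<in> S}"

lemma double_subalgebra_carrier_mat: "double_subalgebra n (carrier_mat n n)"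
  by (auto simp: double_subalgebra_def linear_subspace_mat_def all_ones_mat_def
      hadamard_prod_def)

lemma double_subalgebra_generated:
  assumes "a \<in> carrier_mat n n"
  shows "double_subalgebra n (generated_double_algebra n a)" "a \<in> generated_double_algebra n a"
proof -
  have "generated_double_algebra n a \<subseteq> carrier_mat n n"
    using assms double_subalgebra_carrier_mat unfolding generated_double_algebra_def by blast
  then show "double_subalgebra n (generated_double_algebra n a)"
    unfolding double_subalgebra_def linear_subspace_mat_def
    by (auto simp: generated_double_algebra_def double_subalgebra_def linear_subspace_mat_def)
  show "a \<in> generated_double_algebra n a"
    by (simp add: generated_double_algebra_def)
qed

lemma generated_double_algebra_least:
  "double_subalgebra n S \<Longrightarrow> a \<in> S \<Longrightarrow> generated_double_algebra n a \<subseteq> S"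
  by (auto simp: generated_double_algebra_def)

end

theory Submission
  imports Defs "HOL-Real_Asymp.Real_Asymp"
begin

text \<open>
  Let \<open>S\<close> be the generated algebra and call two vertices equivalent if every element of \<open>S\<close> has
  equal diagonal entries at both. Hadamard polynomials show that the diagonal indicator \<open>D\<close> of each
  class lies in \<open>S\<close>. If all classes are singletons, then \<open>S\<close> contains all matrix units
  \<open>E\<^bsub>uu\<^esub> J E\<^bsub>vv\<^esub>\<close> and is full. In any case, the diagonal of \<open>A D J\<close> shows that the
  partition is equitable over the field: equivalent vertices have the same number of neighbours in
  each class, as elements of the field.

  A first moment bound rules out nontrivial equitable partitions. For a partition into \<open>m < n\<close>
  classes, about \<open>(m + 1) (n - m) / 2\<close> edges of an equitable graph are determined by the others, by
  cancellation in the field, whatever its characteristic. There are at most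
  \<open>(n choose m) m\<^bsup>n - m\<^esup>\<close> such partitions, and \<open>m 2\<^bsup>- (m + 1) / 2\<^esup> \<le> 3 / 4\<close> for all \<open>m\<close>, so
  the union bound tends to 0.
\<close>

subsection \<open>Equitable partitions from the generated algebra\<close>

text \<open>Counting in \<open>'a\<close> means counting modulo the characteristic, which is what
  diagonal entries of matrix products over a field record.\<close>

definition nbr_count :: "nat set set \<Rightarrow> nat \<Rightarrow> nat set \<Rightarrow> 'a :: semiring_1" where
  "nbr_count E v X = (\<Sum>x\<in>X. of_bool ({v, x} \<in> E))"

text \<open>The classes are the fibres of \<open>r\<close> on \<open>{..<n}\<close>, each named by a
  member \<open>w\<close>; the type argument fixes the semiring in which counts are
  compared.\<close>

definition equitable :: "'a :: semiring_1 itself \<Rightarrow> nat \<Rightarrow> (nat \<Rightarrow> nat) \<Rightarrow> nat set set \<Rightarrow> bool" where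
  "equitable _ n r E \<longleftrightarrow> (\<forall>u<n. \<forall>v<n. \<forall>w<n. r u = r v \<longrightarrow>
     (nbr_count E u {x. x < n \<and> r x = r w} :: 'a) = nbr_count E v {x. x < n \<and> r x = r w})"

definition diag_equiv :: "nat \<Rightarrow> 'a :: field mat set \<Rightarrow> nat \<Rightarrow> nat \<Rightarrow> bool" where
  "diag_equiv n S u v \<longleftrightarrow> u < n \<and> v < n \<and> (\<forall>B\<in>S. B $$ (u, u) = B $$ (v, v))"

text \<open>Lagrange interpolation with Hadamard products: each vertex \<open>v\<close> outside the
  class of \<open>w\<close> contributes a factor that is 0 at \<open>v\<close> and 1 at
  \<open>w\<close>. The product is 1 on the whole class, since diagonals of elements of
  \<open>S\<close> are constant there, and a Hadamard product with the identity clears the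
  off-diagonal entries.\<close>

lemma diag_class_mem:
  fixes S :: "'a :: field mat set"
  assumes S: "double_subalgebra n S" and w: "w < n"
  shows "Matrix.mat n n (\<lambda>(i, j). of_bool (i = j \<and> diag_equiv n S i w)) \<in> S"
proof -
  have sub: "S \<subseteq> carrier_mat n n" and one: "1\<^sub>m n \<in> S" and J: "all_ones_mat n \<in> S"
    and add: "\<And>A B. A \<in> S \<Longrightarrow> B \<in> S \<Longrightarrow> A + B \<in> S"
    and smult: "\<And>c A. A \<in> S \<Longrightarrow> c \<cdot>\<^sub>m A \<in> S"
    and had: "\<And>A B. A \<in> S \<Longrightarrow> B \<in> S \<Longrightarrow> hadamard_prod A B \<in> S"
    using S by (auto simp: double_subalgebra_def linear_subspace_mat_def)
  have "\<exists>C\<in>S. C $$ (w, w) = 1 \<and> (\<forall>v\<in>T. C $$ (v, v) = 0)"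
    if "finite T" "T \<subseteq> {v. v < n \<and> \<not> diag_equiv n S v w}" for T
    using that
  proof (induction T rule: finite_induct)
    case empty
    show ?case using one w by (auto intro!: bexI[of _ "1\<^sub>m n"])
  next
    case (insert v T)
    then obtain C where C: "C \<in> S" "C $$ (w, w) = 1" "\<forall>v\<in>T. C $$ (v, v) = 0" by auto
    from insert.prems w obtain B where B: "B \<in> S" "B $$ (v, v) \<noteq> B $$ (w, w)"
      by (auto simp: diag_equiv_def)
    \<comment> \<open>As the all-ones matrix is the Hadamard unit, this is the linear polynomial in
      \<open>B\<close> whose diagonal entry is 0 at \<open>v\<close> and 1 at
      \<open>w\<close>.\<close>
    define M where "M = (1 / (B $$ (w, w) - B $$ (v, v))) \<cdot>\<^sub>m (B + (- B $$ (v, v)) \<cdot>\<^sub>m all_ones_mat n)"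
    have M: "M \<in> S" unfolding M_def by (intro smult add B J)
    have carr: "B \<in> carrier_mat n n" "C \<in> carrier_mat n n" "M \<in> carrier_mat n n"
      using B C M sub by auto
    have Mi: "M $$ (i, i) = (B $$ (i, i) - B $$ (v, v)) / (B $$ (w, w) - B $$ (v, v))" if "i < n" for i
      using that carr by (auto simp: M_def all_ones_mat_def)
    have "hadamard_prod M C $$ (i, i) = M $$ (i, i) * C $$ (i, i)" if "i < n" for i
      using that carr by (auto simp: hadamard_prod_def)
    then have "hadamard_prod M C $$ (w, w) = 1 \<and> (\<forall>v\<in>insert v T. hadamard_prod M C $$ (v, v) = 0)"
      using insert.prems C B w Mi by (auto simp: subset_iff)
    then show ?case using had[OF M C(1)] by blast
  qed
  from this[of "{v. v < n \<and> \<not> diag_equiv n S v w}"]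
  obtain C where C: "C \<in> S" "C $$ (w, w) = 1" "\<And>v. v < n \<Longrightarrow> \<not> diag_equiv n S v w \<Longrightarrow> C $$ (v, v) = 0"
    by auto
  have "C $$ (v, v) = 1" if "diag_equiv n S v w" for v
    using that C by (auto simp: diag_equiv_def)
  then have "hadamard_prod C (1\<^sub>m n) = Matrix.mat n n (\<lambda>(i, j). of_bool (i = j \<and> diag_equiv n S i w))"
    using C sub by (intro eq_matI) (auto simp: hadamard_prod_def)
  with had[OF C(1) one] show ?thesis by simp
qed

text \<open>Multiplying by the all-ones matrix copies the class indicator into every column, so a
  further product with the adjacency matrix has the neighbour counts on its diagonal. This product
  lies in \<open>S\<close>, so equivalent vertices share the entry.\<close>

lemma nbr_count_diag_class:
  fixes S :: "'a :: field mat set"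
  assumes S: "double_subalgebra n S" and A: "adjacency_mat n E \<in> S" and w: "w < n"
    and uv: "diag_equiv n S u v"
  shows "(nbr_count E u {x. diag_equiv n S x w} :: 'a) = nbr_count E v {x. diag_equiv n S x w}"
proof -
  let ?D = "Matrix.mat n n (\<lambda>(i, j). of_bool (i = j \<and> diag_equiv n S i w)) :: 'a mat"
  have sets: "{x. diag_equiv n S x w} = {x\<in>{0..<n}. diag_equiv n S x w}"
    by (auto simp: diag_equiv_def)
  have "(\<Sum>k=0..<n. of_bool (i = k \<and> diag_equiv n S i w)) = (of_bool (diag_equiv n S i w) :: 'a)"
    if "i < n" for i
  proof -
    have "(\<Sum>k=0..<n. of_bool (i = k \<and> diag_equiv n S i w)) =
        (\<Sum>k=0..<n. if k = i then of_bool (diag_equiv n S i w) else 0 :: 'a)"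
      by (intro sum.cong) auto
    with that show ?thesis by simp
  qed
  then have DJ: "?D * all_ones_mat n = Matrix.mat n n (\<lambda>(i, j). of_bool (diag_equiv n S i w))"
    by (intro eq_matI) (simp_all add: scalar_prod_def all_ones_mat_def)
  have "adjacency_mat n E * (?D * all_ones_mat n) \<in> S"
    using S A diag_class_mem[OF S w] by (auto simp: double_subalgebra_def)
  moreover have "(adjacency_mat n E * (?D * all_ones_mat n)) $$ (i, i)
      = nbr_count E i {x. diag_equiv n S x w}" if "i < n" for i
    unfolding DJ sets nbr_count_def using that
    by (simp only: sum.inter_filter finite_atLeastLessThan)
      (auto simp: adjacency_mat_def scalar_prod_def intro!: sum.cong
        simp del: sum_mult_of_bool_eq sum_of_bool_mult_eq sum_of_bool_eq)
  ultimately show ?thesis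
    using uv by (auto simp: diag_equiv_def)
qed

lemma double_subalgebra_eq_carrier:
  fixes S :: "'a :: field mat set"
  assumes S: "double_subalgebra n S" and inj: "\<And>u v. diag_equiv n S u v \<Longrightarrow> u = v"
  shows "S = carrier_mat n n"
proof
  have sub: "S \<subseteq> carrier_mat n n" and zero: "0\<^sub>m n n \<in> S" and J: "all_ones_mat n \<in> S"
    and add: "\<And>A B. A \<in> S \<Longrightarrow> B \<in> S \<Longrightarrow> A + B \<in> S"
    and smult: "\<And>c A. A \<in> S \<Longrightarrow> c \<cdot>\<^sub>m A \<in> S"
    and mult: "\<And>A B. A \<in> S \<Longrightarrow> B \<in> S \<Longrightarrow> A * B \<in> S"
    using S by (auto simp: double_subalgebra_def linear_subspace_mat_def)
  show "S \<subseteq> carrier_mat n n" by fact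
  let ?e = "\<lambda>u v. Matrix.mat n n (\<lambda>ij. of_bool (ij = (u, v))) :: 'a mat"
  have diag: "?e u u \<in> S" if "u < n" for u
  proof -
    have "diag_equiv n S i u \<longleftrightarrow> i = u" for i
      using inj that by (auto simp: diag_equiv_def)
    then have "Matrix.mat n n (\<lambda>(i, j). of_bool (i = j \<and> diag_equiv n S i u)) = ?e u u"
      by (intro eq_matI) auto
    with diag_class_mem[OF S that] show ?thesis by simp
  qed
  have e: "?e u v \<in> S" if "u < n" "v < n" for u v
  proof -
    have "?e u u * all_ones_mat n = Matrix.mat n n (\<lambda>(i, j). of_bool (i = u))"
      using that by (intro eq_matI) (auto simp: scalar_prod_def all_ones_mat_def of_bool_def)
    then have "?e u u * all_ones_mat n * ?e v v = ?e u v"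
      using that by (intro eq_matI) (auto simp: scalar_prod_def of_bool_def)
    with mult[OF mult[OF diag[OF that(1)] J] diag[OF that(2)]] show ?thesis by simp
  qed
  show "carrier_mat n n \<subseteq> S"
  proof
    fix M :: "'a mat" assume M: "M \<in> carrier_mat n n"
    have "Matrix.mat n n (\<lambda>ij. if ij \<in> T then M $$ ij else 0) \<in> S"
      if "finite T" "T \<subseteq> {..<n} \<times> {..<n}" for T
      using that
    proof (induction T rule: finite_induct)
      case empty
      have "Matrix.mat n n (\<lambda>ij. 0) = (0\<^sub>m n n :: 'a mat)" by (intro eq_matI) auto
      then show ?case using zero by simp
    next
      case (insert p T)
      obtain u v where p: "p = (u, v)" by (cases p)
      have "Matrix.mat n n (\<lambda>ij. if ij \<in> insert p T then M $$ ij else 0)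
        = Matrix.mat n n (\<lambda>ij. if ij \<in> T then M $$ ij else 0) + M $$ p \<cdot>\<^sub>m ?e u v"
        using insert.hyps p by (intro eq_matI) auto
      then show ?case using insert p by (auto intro!: add smult e)
    qed
    from this[of "{..<n} \<times> {..<n}"]
    have "Matrix.mat n n (\<lambda>ij. if ij \<in> {..<n} \<times> {..<n} then M $$ ij else 0) \<in> S" by simp
    moreover have "Matrix.mat n n (\<lambda>ij. if ij \<in> {..<n} \<times> {..<n} then M $$ ij else 0) = M"
      using M by (intro eq_matI) auto
    ultimately show "M \<in> S" by simp
  qed
qed

text \<open>A partition is encoded by a set \<open>R\<close> of representatives and a map
  \<open>s\<close> sending every other vertex to its representative, a form that is easy to count.
  \<open>R\<close> is proper because two distinct vertices are equivalent when the algebra is not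
  full.\<close>

lemma exists_equitable:
  assumes "generated_double_algebra n (adjacency_mat n E :: 'a :: field mat) \<noteq> carrier_mat n n"
  obtains R s where "R \<subset> {..<n}" "s \<in> ({..<n} - R) \<rightarrow>\<^sub>E R"
    "equitable TYPE('a) n (\<lambda>v. if v \<in> R then v else s v) E"
proof -
  define S where "S = generated_double_algebra n (adjacency_mat n E :: 'a mat)"
  have "(adjacency_mat n E :: 'a mat) \<in> carrier_mat n n" by (simp add: adjacency_mat_def)
  from double_subalgebra_generated[OF this]
  have S: "double_subalgebra n S" "adjacency_mat n E \<in> S" by (simp_all add: S_def)
  obtain a b where ab: "diag_equiv n S a b" "a \<noteq> b"
    using double_subalgebra_eq_carrier[OF S(1)] assms by (auto simp: S_def)
  define r where "r v = (LEAST u. diag_equiv n S u v)" for v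
  have refl: "diag_equiv n S v v" if "v < n" for v using that by (simp add: diag_equiv_def)
  have sym: "diag_equiv n S u v \<Longrightarrow> diag_equiv n S v u" for u v by (auto simp: diag_equiv_def)
  have trans: "diag_equiv n S u v \<Longrightarrow> diag_equiv n S v w \<Longrightarrow> diag_equiv n S u w" for u v w
    by (auto simp: diag_equiv_def)
  have r: "diag_equiv n S (r v) v" if "v < n" for v
    unfolding r_def using refl[OF that] by (rule LeastI)
  have r_eq: "r u = r v \<longleftrightarrow> diag_equiv n S u v" if "u < n" "v < n" for u v
  proof
    assume "r u = r v"
    then have "diag_equiv n S (r u) v" using r[OF that(2)] by simp
    with sym[OF r[OF that(1)]] show "diag_equiv n S u v" by (rule trans)
  next
    assume uv: "diag_equiv n S u v"
    have "diag_equiv n S x u \<longleftrightarrow> diag_equiv n S x v" for x using uv sym trans by blast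
    then show "r u = r v" by (simp add: r_def)
  qed
  have r_less: "r v < n" if "v < n" for v using r[OF that] by (simp add: diag_equiv_def)
  have r_r: "r (r v) = r v" if "v < n" for v using r r_eq r_less that by blast
  define R where "R = r ` {..<n}"
  have R: "v \<in> R \<longleftrightarrow> v < n \<and> r v = v" for v
    unfolding R_def using r_r r_less by (force simp: image_iff)
  have ab_less: "a < n" "b < n" using ab by (auto simp: diag_equiv_def)
  have "r a = r b" using ab r_eq ab_less by blast
  then have "\<not> (a \<in> R \<and> b \<in> R)" using ab(2) by (auto simp: R)
  then have "R \<subset> {..<n}" using R ab_less by auto
  moreover have "restrict r ({..<n} - R) \<in> ({..<n} - R) \<rightarrow>\<^sub>E R" by (auto simp: R_def)
  moreover have "equitable TYPE('a) n (\<lambda>v. if v \<in> R then v else restrict r ({..<n} - R) v) E"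
  proof -
    have eq: "(if v \<in> R then v else restrict r ({..<n} - R) v) = r v" if "v < n" for v
      using that by (auto simp: R)
    have "{x. x < n \<and> (if x \<in> R then x else restrict r ({..<n} - R) x) = r w} = {x. diag_equiv n S x w}"
      if "w < n" for w
    proof -
      have "{x. x < n \<and> (if x \<in> R then x else restrict r ({..<n} - R) x) = r w} = {x. x < n \<and> r x = r w}"
        by (simp only: eq cong: conj_cong)
      also have "\<dots> = {x. diag_equiv n S x w}"
        using that r_eq by (auto simp: diag_equiv_def)
      finally show ?thesis .
    qed
    with eq r_eq nbr_count_diag_class[OF S] show ?thesis unfolding equitable_def by presburger
  qed
  ultimately show thesis by (rule that)
qed

subsection \<open>The union bound\<close>

text \<open>Squared form of the bound 3/4 on \<open>decay\<close>. Equality holds at 3, where the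
  induction starts; from there on the square at most doubles in each step.\<close>

lemma le_scaled_power2: "16 * m\<^sup>2 \<le> 9 * 2 ^ (m + 1)" for m :: nat
proof (cases "m < 3")
  case True
  then have "m = 0 \<or> m = 1 \<or> m = 2" by auto
  then show ?thesis by auto
next
  case False
  then have "3 \<le> m" by simp
  then show ?thesis
  proof (induction m rule: dec_induct)
    case (step m)
    have "3 * m \<le> m * m" using step by (intro mult_mono) auto
    then have "(Suc m)\<^sup>2 \<le> 2 * m\<^sup>2"
      using step(1) unfolding power2_eq_square mult_Suc mult_Suc_right by linarith
    then show ?case using step by simp
  qed simp
qed

text \<open>Contribution of one non-representative vertex: \<open>m\<close> choices of its class,
  times the probability cost of about \<open>(m + 1) / 2\<close> determined edges.\<close>

definition decay :: "nat \<Rightarrow> real" where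
  "decay m = real m * 2 powr (- (real m + 1) / 2)"

lemma decay_nonneg: "decay m \<ge> 0" by (simp add: decay_def)

lemma decay_le: "decay m \<le> 3 / 4"
proof (rule power2_le_imp_le)
  have "(2 powr (- (real m + 1) / 2))\<^sup>2 = 2 powr (- real (m + 1))"
    by (simp add: power2_eq_square algebra_simps flip: powr_add)
  also have "\<dots> = inverse (2 ^ (m + 1))"
    by (simp only: powr_minus powr_realpow zero_less_numeral)
  finally have "(decay m)\<^sup>2 = (real m)\<^sup>2 / 2 ^ (m + 1)"
    by (simp add: decay_def power_mult_distrib field_simps)
  moreover have "16 * (real m)\<^sup>2 \<le> 9 * 2 ^ (m + 1)"
    using of_nat_mono[OF le_scaled_power2[of m], where 'a = real]
    by (simp only: of_nat_mult of_nat_numeral of_nat_power)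
  ultimately show "(decay m)\<^sup>2 \<le> (3 / 4)\<^sup>2" by (simp add: power_divide divide_le_eq)
qed simp

text \<open>Bound on the expected number of equitable pairs \<open>(R, s)\<close> with
  \<open>card R = m\<close>. The summand \<open>min m (n - m)\<close> pays for edges that are kept
  for comparison.\<close>

definition partition_term :: "nat \<Rightarrow> nat \<Rightarrow> real" where
  "partition_term n m = real (n choose m) *
     (real m ^ (n - m) * 2 powr (real (min m (n - m)) - (real m + 1) * real (n - m) / 2))"

lemma partition_term_le:
  assumes "m \<le> n"
  shows "partition_term n m \<le> (2 * real n) ^ min m (n - m) * decay m ^ (n - m)"
proof -
  have c: "n choose m \<le> n ^ min m (n - m)"
    using binomial_le_pow[of m n] binomial_le_pow[of "n - m" n] assms binomial_symmetric[of m n]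
    by (auto simp: min_def)
  have c: "real (n choose m) \<le> real n ^ min m (n - m)"
    using c by (metis of_nat_le_iff of_nat_power)
  have "- (real m + 1) / 2 * real (n - m) = - ((real m + 1) * real (n - m) / 2)"
    by (simp only: times_divide_eq_left minus_mult_left minus_divide_left)
  then have "decay m ^ (n - m) = real m ^ (n - m) * 2 powr - ((real m + 1) * real (n - m) / 2)"
    unfolding decay_def power_mult_distrib by (simp only: powr_powr powr_gt_zero flip: powr_realpow)
  then have "partition_term n m = real (n choose m) * (2 ^ min m (n - m) * decay m ^ (n - m))"
    unfolding partition_term_def diff_conv_add_uminus powr_add by (simp add: powr_realpow)
  also have "\<dots> \<le> real n ^ min m (n - m) * (2 ^ min m (n - m) * decay m ^ (n - m))"
    by (intro mult_right_mono c) (simp add: decay_nonneg)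
  finally show ?thesis by (simp add: power_mult_distrib mult_ac)
qed

text \<open>Split at \<open>sqrt n\<close>. For small \<open>m\<close> the factor
  \<open>(3 / 4) ^ (n - m)\<close> beats \<open>(2 * real n) ^ m\<close>; for large \<open>m\<close>
  already \<open>decay m\<close> beats every polynomial in \<open>n\<close>.\<close>

lemma sum_partition_term_tendsto_0: "(\<lambda>n. \<Sum>m<n. partition_term n m) \<longlonglongrightarrow> 0"
proof (rule tendsto_sandwich)
  let ?a = "\<lambda>n. (2 * real n) powr sqrt n * (3 / 4) powr (real n - sqrt n)"
  let ?b = "\<lambda>n. 2 * (real n)\<^sup>2 * 2 powr (- sqrt n / 2)"
  show "\<forall>\<^sub>F n in sequentially. 0 \<le> (\<Sum>m<n. partition_term n m)"
    by (intro always_eventually allI sum_nonneg) (simp add: partition_term_def)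
  have "\<forall>\<^sub>F n in sequentially. ?b n \<le> 1" by real_asymp
  then show "\<forall>\<^sub>F n in sequentially. (\<Sum>m<n. partition_term n m) \<le> real n * (?a n + ?b n)"
    using eventually_gt_at_top[of 0]
  proof eventually_elim
    case (elim n)
    have "partition_term n m \<le> ?a n + ?b n" if "m < n" for m
    proof (cases "real m \<le> sqrt n")
      case True
      have "(2 * real n) ^ min m (n - m) \<le> (2 * real n) ^ m"
        using elim by (intro power_increasing) auto
      also have "\<dots> = (2 * real n) powr m" using elim by (simp add: powr_realpow)
      also have "\<dots> \<le> (2 * real n) powr sqrt n" using True elim by (intro powr_mono) auto
      finally have 1: "(2 * real n) ^ min m (n - m) \<le> (2 * real n) powr sqrt n" .
      have "decay m ^ (n - m) \<le> (3 / 4) ^ (n - m)"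
        by (intro power_mono decay_le decay_nonneg)
      also have "\<dots> = (3 / 4) powr (real n - real m)"
        using that by (simp add: of_nat_diff flip: powr_realpow)
      also have "\<dots> \<le> (3 / 4) powr (real n - sqrt n)"
        using True by (intro powr_mono') auto
      finally have "decay m ^ (n - m) \<le> (3 / 4) powr (real n - sqrt n)" .
      with 1 have "partition_term n m \<le> ?a n"
        using that decay_nonneg by (intro order_trans[OF partition_term_le mult_mono]) auto
      moreover have "0 \<le> ?b n" by simp
      ultimately show ?thesis by linarith
    next
      case False
      have "decay m \<le> real n * 2 powr (- sqrt n / 2)"
        unfolding decay_def using False that by (intro mult_mono powr_mono) auto
      then have "2 * real n * decay m \<le> 2 * real n * (real n * 2 powr (- sqrt n / 2))"
        by (intro mult_left_mono) auto
      then have b: "2 * real n * decay m \<le> ?b n" by (simp add: power2_eq_square mult_ac)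
      have "partition_term n m \<le> (2 * real n) ^ min m (n - m) * decay m ^ (n - m)"
        using that by (intro partition_term_le) auto
      also have "\<dots> \<le> (2 * real n) ^ (n - m) * decay m ^ (n - m)"
        using elim decay_nonneg by (intro mult_right_mono power_increasing) auto
      also have "\<dots> = (2 * real n * decay m) ^ (n - m)" by (simp add: power_mult_distrib)
      \<comment> \<open>The base is at most \<open>?b n\<close>, hence at most 1, and the exponent
        is at least 1 because \<open>m < n\<close>.\<close>
      also have "\<dots> \<le> (2 * real n * decay m) ^ 1"
        using that b elim decay_nonneg[of m] by (intro power_decreasing) auto
      finally have "partition_term n m \<le> ?b n" using b by simp
      moreover have "0 \<le> ?a n" by simp
      ultimately show ?thesis by linarith
    qed
    then have "(\<Sum>m<n. partition_term n m) \<le> (\<Sum>m<n. ?a n + ?b n)" by (intro sum_mono) auto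
    then show ?case by simp
  qed
  show "(\<lambda>n. real n * (?a n + ?b n)) \<longlonglongrightarrow> 0" by real_asymp
qed simp

subsection \<open>The probability that a partition is equitable\<close>

lemma finite_vertex_pairs: "finite (vertex_pairs n)"
  unfolding vertex_pairs_def by (rule finite_subset[of _ "Pow {..<n}"]) auto

lemma erdos_renyi_half: "erdos_renyi n (1/2) = pmf_of_set (Pow (vertex_pairs n))"
  unfolding erdos_renyi_def by (rule pmf_of_set_Pow_conv_bernoulli[OF finite_vertex_pairs])

text \<open>Deleting \<open>D\<close> is injective on the graphs in \<open>B\<close>, so they number
  at most \<open>2 ^ (card ?V - card D)\<close> out of \<open>2 ^ card ?V\<close>.\<close>

lemma prob_determined_le:
  assumes D: "D \<subseteq> vertex_pairs n"
    and det: "\<And>E E'. E \<in> B \<Longrightarrow> E' \<in> B \<Longrightarrow> E \<subseteq> vertex_pairs n \<Longrightarrow> E' \<subseteq> vertex_pairs n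
      \<Longrightarrow> E - D = E' - D \<Longrightarrow> E = E'"
  shows "measure_pmf.prob (erdos_renyi n (1/2)) B \<le> 2 powr (- real (card D))"
proof -
  let ?V = "vertex_pairs n"
  note fin = finite_vertex_pairs[of n]
  have "card (Pow ?V \<inter> B) = card ((\<lambda>E. E - D) ` (Pow ?V \<inter> B))"
    by (intro card_image[symmetric] inj_onI) (auto dest: det)
  also have "\<dots> \<le> card (Pow (?V - D))" using fin by (intro card_mono) auto
  also have "\<dots> = 2 ^ (card ?V - card D)"
    using fin D by (simp add: card_Pow card_Diff_subset finite_subset)
  finally have "real (card (Pow ?V \<inter> B)) \<le> 2 ^ (card ?V - card D)"
    by (metis of_nat_le_iff of_nat_numeral of_nat_power)
  then have "measure_pmf.prob (erdos_renyi n (1/2)) B \<le> 2 ^ (card ?V - card D) / 2 ^ card ?V"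
    unfolding erdos_renyi_half
    by (subst measure_pmf_of_set) (use fin in \<open>auto simp: card_Pow divide_right_mono\<close>)
  also have "\<dots> = 2 powr (- real (card D))"
    using card_mono[OF fin D] by (simp add: powr_minus powr_realpow power_diff field_simps)
  finally show ?thesis .
qed

text \<open>Lower bound for the number of determined edges. Classes are ordered by size, ties broken
  by label. Each class is also paired with itself and then counts in full, not by half; this gives
  \<open>card R + 1\<close> in place of \<open>card R\<close>.\<close>

lemma card_ordered_pairs_ge:
  fixes R W :: "nat set" and r :: "nat \<Rightarrow> nat"
  assumes fin: "finite R" "finite W" and r: "r ` W \<subseteq> R"
  defines "g \<equiv> \<lambda>\<sigma>. card {w\<in>W. r w = \<sigma>}"
  shows "(card R + 1) * card W \<le>
    2 * card {(w, \<rho>). w \<in> W \<and> \<rho> \<in> R \<and> (g \<rho> < g (r w) \<or> g \<rho> = g (r w) \<and> \<rho> \<le> r w)}"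
proof -
  define le where "le \<rho> \<sigma> \<longleftrightarrow> g \<rho> < g \<sigma> \<or> g \<rho> = g \<sigma> \<and> \<rho> \<le> \<sigma>" for \<rho> \<sigma>
  define h where "h \<sigma> \<rho> = (if le \<rho> \<sigma> then g \<sigma> else 0)" for \<sigma> \<rho>
  have by_class: "(\<Sum>w\<in>W. f (r w)) = (\<Sum>\<sigma>\<in>R. g \<sigma> * f \<sigma>)" for f :: "nat \<Rightarrow> nat"
  proof -
    have "(\<Sum>w\<in>W. f (r w)) = (\<Sum>\<sigma>\<in>R. \<Sum>w\<in>{w\<in>W. r w = \<sigma>}. f (r w))"
      using fin r by (intro sum.group[symmetric]) auto
    also have "\<dots> = (\<Sum>\<sigma>\<in>R. g \<sigma> * f \<sigma>)" by (intro sum.cong) (auto simp: g_def)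
    finally show ?thesis .
  qed
  have "{(w, \<rho>). w \<in> W \<and> \<rho> \<in> R \<and> le \<rho> (r w)} = (SIGMA w:W. {\<rho>\<in>R. le \<rho> (r w)})" by auto
  then have "card {(w, \<rho>). w \<in> W \<and> \<rho> \<in> R \<and> le \<rho> (r w)} = (\<Sum>w\<in>W. card {\<rho>\<in>R. le \<rho> (r w)})"
    using fin by simp
  also have "\<dots> = (\<Sum>\<sigma>\<in>R. g \<sigma> * card {\<rho>\<in>R. le \<rho> \<sigma>})" by (rule by_class)
  also have "\<dots> = (\<Sum>\<sigma>\<in>R. \<Sum>\<rho>\<in>R. h \<sigma> \<rho>)"
    using fin by (intro sum.cong) (auto simp: h_def mult.commute simp flip: sum.inter_filter)
  finally have card: "card {(w, \<rho>). w \<in> W \<and> \<rho> \<in> R \<and> le \<rho> (r w)} = (\<Sum>\<sigma>\<in>R. \<Sum>\<rho>\<in>R. h \<sigma> \<rho>)" .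
  have total: "(\<Sum>\<sigma>\<in>R. g \<sigma>) = card W" using by_class[of "\<lambda>_. 1"] by simp
  \<comment> \<open>for two classes the larger one counts, which is at least half of the sum of their sizes\<close>
  have "2 * card R * card W + 2 * card W = (\<Sum>\<sigma>\<in>R. \<Sum>\<rho>\<in>R. g \<sigma> + g \<rho> + (if \<rho> = \<sigma> then 2 * g \<sigma> else 0))"
    using fin by (simp add: sum.distrib total flip: sum_distrib_left)
  also have "\<dots> \<le> (\<Sum>\<sigma>\<in>R. \<Sum>\<rho>\<in>R. 2 * (h \<sigma> \<rho> + h \<rho> \<sigma>))"
    by (intro sum_mono) (auto simp: h_def le_def)
  also have "\<dots> = 2 * ((\<Sum>\<sigma>\<in>R. \<Sum>\<rho>\<in>R. h \<sigma> \<rho>) + (\<Sum>\<sigma>\<in>R. \<Sum>\<rho>\<in>R. h \<rho> \<sigma>))"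
    by (simp add: sum.distrib sum_distrib_left)
  also have "(\<Sum>\<sigma>\<in>R. \<Sum>\<rho>\<in>R. h \<rho> \<sigma>) = (\<Sum>\<sigma>\<in>R. \<Sum>\<rho>\<in>R. h \<sigma> \<rho>)" by (rule sum.swap)
  finally show ?thesis using card by (simp add: le_def)
qed

text \<open>A set \<open>D\<close> of edges is determined by the rest, with at least
  \<open>(m + 1) * (n - m) / 2\<close> edges up to a loss of one per class that has a
  non-representative. There are at most \<open>min m (n - m)\<close> such classes.\<close>

lemma prob_equitable_le:
  assumes R: "R \<subseteq> {..<n}" and s: "s \<in> ({..<n} - R) \<rightarrow>\<^sub>E R"
  defines "m \<equiv> card R"
  shows "measure_pmf.prob (erdos_renyi n (1/2))
      {E. equitable TYPE('a :: field) n (\<lambda>v. if v \<in> R then v else s v) E}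
    \<le> 2 powr (real (min m (n - m)) - (real m + 1) * real (n - m) / 2)"
proof -
  define W where "W = {..<n} - R"
  define r where "r v = (if v \<in> R then v else s v)" for v
  define g where "g \<sigma> = card {w\<in>W. r w = \<sigma>}" for \<sigma>
  define le where "le \<rho> \<sigma> \<longleftrightarrow> g \<rho> < g \<sigma> \<or> g \<rho> = g \<sigma> \<and> \<rho> \<le> \<sigma>" for \<rho> \<sigma>
  \<comment> \<open>The choice is meaningful only for classes with a member in \<open>W\<close>; it
    is applied only to \<open>r w\<close> with \<open>w\<close> in \<open>W\<close>.\<close>
  define z where "z \<rho> = (SOME w. w \<in> W \<and> r w = \<rho>)" for \<rho>
  have fin: "finite R" "finite W" using R finite_subset by (auto simp: W_def)
  have r_R: "r \<rho> = \<rho>" if "\<rho> \<in> R" for \<rho> using that by (simp add: r_def)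
  have r_W: "r w \<in> R" if "w \<in> W" for w using that s by (auto simp: r_def W_def)
  have z: "z (r w) \<in> W \<and> r (z (r w)) = r w" if "w \<in> W" for w
    unfolding z_def by (rule someI[of _ w]) (use that in auto)
  have antisym: "le \<rho> \<sigma> \<Longrightarrow> le \<sigma> \<rho> \<Longrightarrow> \<rho> = \<sigma>" for \<rho> \<sigma> by (auto simp: le_def)
  have W_R: "w \<notin> R" "w < n" if "w \<in> W" for w using that by (auto simp: W_def)
  \<comment> \<open>The edges between two classes from the non-representatives of the larger class to the
    representative of the smaller one can be recovered from all other edges: the count of the
    larger class's representative into the smaller class is known. Within a class, the
    representative's edges play this role, and the edge to one further vertex \<open>z\<close> has to be kept
    for comparison.\<close>
  define Q where "Q = {(w, \<rho>). w \<in> W \<and> \<rho> \<in> R \<and> le \<rho> (r w)}"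
  define X where "X = {w\<in>W. w = z (r w)}"
  define P where "P = Q - (\<lambda>w. (w, r w)) ` X"
  define D where "D = (\<lambda>(w, \<rho>). {w, \<rho>}) ` P"
  have P_iff: "(w, \<rho>) \<in> P \<longleftrightarrow> w \<in> W \<and> \<rho> \<in> R \<and> le \<rho> (r w) \<and> \<not> (\<rho> = r w \<and> w = z (r w))" for w \<rho>
    by (auto simp: P_def Q_def X_def)
  have D_iff: "{w, \<rho>} \<in> D \<longleftrightarrow> (w, \<rho>) \<in> P" if "\<rho> \<in> R" for w \<rho>
    using that by (auto simp: D_def P_iff doubleton_eq_iff dest: W_R intro!: rev_image_eqI[of "(w, \<rho>)"])
  have D_W: "{w, x} \<notin> D" if "w \<in> W" "x \<in> W" for w x
    using that by (auto simp: D_def P_iff doubleton_eq_iff dest: W_R)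
  have inj: "inj_on (\<lambda>(w, \<rho>). {w, \<rho>}) P"
    by (auto simp: inj_on_def P_iff doubleton_eq_iff dest: W_R)
  have D_sub: "D \<subseteq> vertex_pairs n"
    using R by (auto simp: D_def P_iff vertex_pairs_def W_def card_insert_if)

  have card_W: "card W = n - m" using R by (simp add: W_def m_def card_Diff_subset finite_subset)
  have "card X \<le> card W" using fin by (intro card_mono) (auto simp: X_def)
  moreover have "card X \<le> card R"
  proof (rule card_inj_on_le)
    show "inj_on r X" by (rule inj_on_inverseI[of _ z]) (simp add: X_def)
  qed (use fin r_W in \<open>auto simp: X_def\<close>)
  ultimately have "card X \<le> min m (n - m)" by (simp add: card_W m_def)
  moreover have "card Q - card X \<le> card P"
  proof -
    have "card ((\<lambda>w. (w, r w)) ` X) \<le> card X" using fin by (intro card_image_le) (auto simp: X_def)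
    moreover have "card Q - card ((\<lambda>w. (w, r w)) ` X) \<le> card P"
      unfolding P_def using fin by (intro diff_card_le_card_Diff) (auto simp: X_def)
    ultimately show ?thesis by linarith
  qed
  moreover have "card D = card P" unfolding D_def by (rule card_image[OF inj])
  ultimately have "card Q \<le> card D + min m (n - m)" by linarith
  moreover have "(m + 1) * (n - m) \<le> 2 * card Q"
    using card_ordered_pairs_ge[OF fin, of r] r_W by (auto simp: Q_def le_def g_def card_W m_def)
  ultimately have "(m + 1) * (n - m) \<le> 2 * (card D + min m (n - m))"
    using mult_le_mono2 order_trans by blast
  then have "real ((m + 1) * (n - m)) \<le> real (2 * (card D + min m (n - m)))" by (rule of_nat_mono)
  then have "(real m + 1) * real (n - m) \<le> 2 * (real (card D) + real (min m (n - m)))"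
    by (simp only: of_nat_mult of_nat_add of_nat_1 of_nat_numeral)
  moreover have "- b \<le> c - a / 2" if "a \<le> 2 * (b + c)" for a b c :: real
    using that by (simp add: field_simps)
  ultimately have le: "- real (card D) \<le> real (min m (n - m)) - (real m + 1) * real (n - m) / 2" by blast

  have "measure_pmf.prob (erdos_renyi n (1/2)) {E. equitable TYPE('a) n r E} \<le> 2 powr (- real (card D))"
  proof (rule prob_determined_le[OF D_sub])
    fix E E' assume "E \<in> {E. equitable TYPE('a) n r E}" "E' \<in> {E. equitable TYPE('a) n r E}"
    then have E: "equitable TYPE('a) n r E" and E': "equitable TYPE('a) n r E'" by auto
    assume diff: "E - D = E' - D"
    have same: "e \<in> E \<longleftrightarrow> e \<in> E'" if "e \<notin> D" for e using diff that by blast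
    have "{w, \<rho>} \<in> E \<longleftrightarrow> {w, \<rho>} \<in> E'" if p: "(w, \<rho>) \<in> P" for w \<rho>
    proof -
      have w: "w \<in> W" "w < n" and \<rho>: "\<rho> \<in> R" "\<rho> < n" using p R by (auto simp: P_iff W_def)
      let ?C = "{x. x < n \<and> r x = r \<rho>}"
      have C: "x = \<rho> \<or> x \<in> W \<and> r x = \<rho>" if "x \<in> ?C" for x
        using that r_R \<rho> by (auto simp: W_def)
      \<comment> \<open>The comparison vertex \<open>y\<close> lies in the class of \<open>w\<close>
        and has all its edges into \<open>?C\<close> outside \<open>D\<close>. For two different
        classes, antisymmetry of \<open>le\<close> ensures this for the representative
        \<open>r w\<close>.\<close>
      obtain y where y: "y < n" "r y = r w" "\<And>x. x \<in> ?C \<Longrightarrow> {y, x} \<notin> D"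
      proof (cases "\<rho> = r w")
        case True
        have zw: "z (r w) \<in> W" "r (z (r w)) = r w" using z w by auto
        have "{z (r w), x} \<notin> D" if "x \<in> ?C" for x
          using C[OF that] zw \<rho> True D_W D_iff by (auto simp: P_iff)
        then show thesis using zw by (intro that[of "z (r w)"]) (auto dest: W_R)
      next
        case False
        have rw: "r w \<in> R" using r_W w by auto
        have "{r w, x} \<notin> D" if "x \<in> ?C" for x
          using C[OF that]
        proof
          assume "x = \<rho>"
          then show ?thesis using D_iff[OF \<rho>(1), of "r w"] rw W_R by (auto simp: P_iff)
        next
          assume x: "x \<in> W \<and> r x = \<rho>"
          have "\<not> le (r w) \<rho>" using p antisym False by (auto simp: P_iff)
          then show ?thesis using x D_iff[OF rw, of x] by (auto simp: P_iff insert_commute)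
        qed
        then show thesis using rw R r_R by (intro that[of "r w"]) auto
      qed
      \<comment> \<open>This isolates the one unknown edge: the remaining members of
        \<open>?C\<close> are non-representatives, and edges inside \<open>W\<close> avoid
        \<open>D\<close>.\<close>
      have count: "nbr_count F w ?C = (of_bool ({w, \<rho>} \<in> F) + (\<Sum>x\<in>?C - {\<rho>}. of_bool ({w, x} \<in> F)) :: 'a)" for F
        unfolding nbr_count_def using \<rho> by (intro sum.remove) auto
      have eq: "nbr_count F w ?C = (nbr_count F y ?C :: 'a)" if "equitable TYPE('a) n r F" for F
        using that w(2) \<rho>(2) y(1) y(2)[symmetric] unfolding equitable_def by blast
      have same_sum: "(\<Sum>x\<in>?C - {\<rho>}. of_bool ({w, x} \<in> E) :: 'a) = (\<Sum>x\<in>?C - {\<rho>}. of_bool ({w, x} \<in> E'))"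
      proof (rule sum.cong[OF refl])
        fix x assume "x \<in> ?C - {\<rho>}"
        then have "{w, x} \<notin> D" using C[of x] D_W w by auto
        then show "(of_bool ({w, x} \<in> E) :: 'a) = of_bool ({w, x} \<in> E')" using same by simp
      qed
      have "nbr_count E w ?C = (nbr_count E y ?C :: 'a)" by (rule eq[OF E])
      also have "\<dots> = nbr_count E' y ?C"
        unfolding nbr_count_def using y(3) same by (intro sum.cong) auto
      also have "\<dots> = nbr_count E' w ?C" by (rule eq[OF E', symmetric])
      finally have "(of_bool ({w, \<rho>} \<in> E) :: 'a) = of_bool ({w, \<rho>} \<in> E')"
        unfolding count same_sum by (rule add_right_imp_eq)
      \<comment> \<open>0 and 1 differ in every field, so the indicator determines the edge in any
        characteristic.\<close>
      then show ?thesis by (simp add: of_bool_eq_iff)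
    qed
    then have "e \<in> E \<longleftrightarrow> e \<in> E'" if "e \<in> D" for e using that by (auto simp: D_def)
    with same show "E = E'" by blast
  qed
  also have "\<dots> \<le> 2 powr (real (min m (n - m)) - (real m + 1) * real (n - m) / 2)"
    using le by (intro powr_mono) auto
  finally show ?thesis unfolding r_def[abs_def] .
qed

section \<open>Summation over all partitions and the limit\<close>

lemma sum_Pow_card:
  fixes \<phi> :: "nat \<Rightarrow> real"
  assumes "finite A"
  shows "(\<Sum>B | B \<subset> A. \<phi> (card B)) = (\<Sum>m<card A. real (card A choose m) * \<phi> m)"
proof -
  have "(\<Sum>B | B \<subset> A. \<phi> (card B))
      = (\<Sum>m\<in>{..<card A}. \<Sum>B\<in>{B \<in> {B. B \<subset> A}. card B = m}. \<phi> (card B))"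
    using assms finite_subset[of "{B. B \<subset> A}" "Pow A"]
    by (intro sum.group[symmetric]) (auto intro: psubset_card_mono)
  also have "\<dots> = (\<Sum>m<card A. real (card A choose m) * \<phi> m)"
  proof (rule sum.cong[OF refl])
    fix m assume "m \<in> {..<card A}"
    then have "{B \<in> {B. B \<subset> A}. card B = m} = {B. B \<subseteq> A \<and> card B = m}" by auto
    then show "(\<Sum>B\<in>{B \<in> {B. B \<subset> A}. card B = m}. \<phi> (card B)) = real (card A choose m) * \<phi> m"
      using n_subsets[OF assms, of m] by simp
  qed
  finally show ?thesis .
qed

text \<open>Union bound over all pairs \<open>(R, s)\<close>. Taking \<open>s\<close> extensional
  leaves exactly \<open>card R ^ (n - card R)\<close> maps for each \<open>R\<close>; grouping the
  sets \<open>R\<close> by size then produces the binomial coefficients.\<close>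

lemma prob_not_full_le:
  "measure_pmf.prob (erdos_renyi n (1/2))
     {E. generated_double_algebra n (adjacency_mat n E :: 'a :: field mat) \<noteq> carrier_mat n n}
   \<le> (\<Sum>m<n. partition_term n m)"
proof -
  let ?p = "measure_pmf.prob (erdos_renyi n (1/2))"
  let ?Q = "\<lambda>R s. {E. equitable TYPE('a) n (\<lambda>v. if v \<in> R then v else s v) E}"
  let ?b = "\<lambda>m. 2 powr (real (min m (n - m)) - (real m + 1) * real (n - m) / 2)"
  have fin: "finite {R. R \<subset> {..<n}}" by (rule finite_subset[of _ "Pow {..<n}"]) auto
  have finR: "finite R" if "R \<subset> {..<n}" for R using that finite_subset by blast
  have "?p {E. generated_double_algebra n (adjacency_mat n E :: 'a mat) \<noteq> carrier_mat n n}
    \<le> ?p (\<Union>R\<in>{R. R \<subset> {..<n}}. \<Union>s\<in>({..<n} - R) \<rightarrow>\<^sub>E R. ?Q R s)"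
    by (intro measure_pmf.finite_measure_mono) (auto elim!: exists_equitable[where 'a = 'a])
  also have "\<dots> \<le> (\<Sum>R | R \<subset> {..<n}. ?p (\<Union>s\<in>({..<n} - R) \<rightarrow>\<^sub>E R. ?Q R s))"
    using fin by (intro measure_pmf.finite_measure_subadditive_finite) auto
  also have "\<dots> \<le> (\<Sum>R | R \<subset> {..<n}. \<Sum>s\<in>({..<n} - R) \<rightarrow>\<^sub>E R. ?p (?Q R s))"
    using finR by (intro sum_mono measure_pmf.finite_measure_subadditive_finite finite_PiE) auto
  also have "\<dots> \<le> (\<Sum>R | R \<subset> {..<n}. \<Sum>s\<in>({..<n} - R) \<rightarrow>\<^sub>E R. ?b (card R))"
    by (intro sum_mono prob_equitable_le) auto
  also have "\<dots> = (\<Sum>R | R \<subset> {..<n}. real (card R) ^ (n - card R) * ?b (card R))"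
    using finR by (intro sum.cong) (auto simp: card_PiE card_Diff_subset psubset_imp_subset)
  also have "\<dots> = (\<Sum>m<n. partition_term n m)"
    by (subst sum_Pow_card[where \<phi> = "\<lambda>m. real m ^ (n - m) * ?b m"]) (simp_all add: partition_term_def)
  finally show ?thesis .
qed

theorem theorem1p3:
  shows "(\<lambda>n. measure_pmf.prob (erdos_renyi n (1/2))
            {E. generated_double_algebra n (adjacency_mat n E :: 'a :: field mat)
                  = carrier_mat n n})
         \<longlonglongrightarrow> 1"
proof -
  let ?bad = "\<lambda>n. {E. generated_double_algebra n (adjacency_mat n E :: 'a mat) \<noteq> carrier_mat n n}"
  have "(\<lambda>n. measure_pmf.prob (erdos_renyi n (1/2)) (?bad n)) \<longlonglongrightarrow> 0"
    by (rule tendsto_sandwich[OF _ _ tendsto_const sum_partition_term_tendsto_0])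
      (auto intro!: always_eventually prob_not_full_le)
  then have "(\<lambda>n. 1 - measure_pmf.prob (erdos_renyi n (1/2)) (?bad n)) \<longlonglongrightarrow> 1 - 0"
    by (intro tendsto_diff tendsto_const)
  moreover have "1 - measure_pmf.prob (erdos_renyi n (1/2)) (?bad n)
      = measure_pmf.prob (erdos_renyi n (1/2)) (- ?bad n)" for n
    using measure_pmf.prob_compl[of "?bad n" "erdos_renyi n (1/2)"] by (simp add: Compl_eq_Diff_UNIV)
  ultimately show ?thesis by (simp add: Collect_neg_eq[symmetric])
qed

end
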